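(* Let $n\ge 52$ and let $m$ be such that $n\in\Gamma_{3,m,1}$. Then $m\ge 7$. Put $$\theta_m^1=\tfrac{t_m+t_{m-2}-1}{2},\quad \theta_m^2=\tfrac{-5t_m+10t_{m-1}+3t_{m-2}-1}{2},\quad \theta_m^3=\tfrac{-t_m+6t_{m-1}-3t_{m-2}-1}{2},$$ $$\eta_m^1=-2t_m+5t_{m-1},\quad \theta_m^4=\tfrac{-t_m+4t_{m-1}+t_{m-2}-1}{2}.$$ Then $\sum_{i=\min\Gamma_{3,m,1}}^{n}a(i)$ is equal to: (i) $\sum_{i=\min\Gamma_{3,m-3,1}}^{n-t_{m-1}}a(i)+n-\min\Gamma_{3,m,1}+1$ if $\theta_m^1\le n<\theta_m^2$; (ii) $\sum_{i=\min\Gamma_{2,m-3,1}}^{n-t_{m-1}}a(i)+\sum a(\Gamma_{3,m-3,1})+n-\min\Gamma_{3,m,1}+1$ if $\theta_m^2\le n<\theta_m^3$; (iii) $\sum_{i=\min\Gamma_{1,m-3,1}}^{n-t_{m-1}}a(i)+\sum a(\Gamma_{3,m-3,1})+\sum a(\Gamma_{2,m-3,1})+n-\min\Gamma_{3,m,1}+1$ if $\theta_m^3\le n<\eta_m^1$; (iv) $\sum_{i=\min\Gamma_{1,m-3,1}}^{n-t_{m-1}}a(i)+\sum a(\Gamma_{3,m-3,1})+\sum a(\Gamma_{2,m-3,1})+\frac{-5t_m+10t_{m-1}-t_{m-2}+1}{2}$ otherwise (that is, if $\eta_m^1\le n<\theta_m^4$).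
   Context: The Tribonacci sequence $\mathbb{T}$ is the fixed point beginning with $a$ of the substitution $\sigma(a)=ab,\ \sigma(b)=ac,\ \sigma(c)=a$; positions are numbered from $1$. For a nonempty factor $\omega$ of $\mathbb{T}$, $\omega_p$ denotes its $p$-th occurrence. The word $\omega_p\omega_{p+1}$ is a (repeated) square if $\omega_{p+1}$ begins immediately after $\omega_p$ ends. For $n\ge 1$, $a(n)$ is the number of pairs $(\omega,p)$ such that $\omega_p\omega_{p+1}$ is a square ending exactly at position $n$. The Tribonacci numbers are $t_m=|\sigma^m(a)|$ for $m\ge 0$ ($t_0=1,t_1=2,t_2=4,t_3=7$, $t_m=t_{m-1}+t_{m-2}+t_{m-3}$). For $m\ge 4$ define the sets of consecutive integers $$\Gamma_{1,m,1}=\left\{\tfrac{t_m+2t_{m-1}-t_{m-2}-1}{2},\dots,\tfrac{t_m+2t_{m-1}+t_{m-2}-3}{2}\right\},$$ $$\Gamma_{2,m,1}=\left\{\tfrac{-t_m+4t_{m-1}+t_{m-2}-1}{2},\dots,\tfrac{t_m+2t_{m-1}-t_{m-2}-3}{2}\right\},$$ $$\Gamma_{3,m,1}=\left\{\tfrac{t_m+t_{m-2}-1}{2},\dots,\tfrac{-t_m+4t_{m-1}+t_{m-2}-3}{2}\right\}.$$ Write $\sum a(\Gamma)=\sum_{i\in\Gamma}a(i)$. *)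

theory Defs
  imports Complex_Main "HOL-Library.Stream"
begin

datatype letter = A | B | C

fun subst :: "letter \<Rightarrow> letter list" where
  "subst A = [A, B]"
| "subst B = [A, C]"
| "subst C = [A]"

definition subst_word :: "letter list \<Rightarrow> letter list" where
  "subst_word u = concat (map subst u)"

definition subst_stream :: "letter stream \<Rightarrow> letter stream" where
  "subst_stream s = flat (smap subst s)"

(* The fixed point of the substitution beginning with A; existence and
   uniqueness are proved in tribonacci_ex1 below. *)
definition tribonacci :: "letter stream" where
  "tribonacci = (THE s. shd s = A \<and> subst_stream s = s)"

definition trib :: "nat \<Rightarrow> nat" where
  "trib m = length ((subst_word ^^ m) [A])"

(* Positions are numbered from 1, whereas sdrop counts from 0. *)
definition occurs_at :: "letter list \<Rightarrow> nat \<Rightarrow> bool" where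
  "occurs_at w i \<longleftrightarrow> 1 \<le> i \<and> stake (length w) (sdrop (i - 1) tribonacci) = w"

definition is_factor :: "letter list \<Rightarrow> bool" where
  "is_factor w \<longleftrightarrow> (\<exists>i. occurs_at w i)"

(* The p-th occurrence of w starts at position i (p counted from 1). *)
definition nth_occurrence :: "letter list \<Rightarrow> nat \<Rightarrow> nat \<Rightarrow> bool" where
  "nth_occurrence w p i \<longleftrightarrow> occurs_at w i \<and> card {j. j \<le> i \<and> occurs_at w j} = p"

(* The p-th occurrence of w starts at some i, the next one starts immediately
   after it ends, and the second copy ends at position n. *)
definition square_ending_at :: "letter list \<Rightarrow> nat \<Rightarrow> nat \<Rightarrow> bool" where
  "square_ending_at w p n \<longleftrightarrow>
     (\<exists>i. nth_occurrence w p i \<and> nth_occurrence w (p + 1) (i + length w)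
        \<and> n = i + 2 * length w - 1)"

definition a :: "nat \<Rightarrow> nat" where
  "a n = card {(w, p). w \<noteq> [] \<and> is_factor w \<and> 1 \<le> p \<and> square_ending_at w p n}"

(* gamma1, gamma2, gamma3 stand for Gamma_{1,m,1}, Gamma_{2,m,1}, Gamma_{3,m,1}.
   They are meant for m >= 4. The endpoints, here and in theta1, ..., theta4
   below, are integers by odd_trib_add. *)
definition gamma1 :: "nat \<Rightarrow> nat set" where
  "gamma1 m = {i. (real (trib m) + 2 * real (trib (m - 1)) - real (trib (m - 2)) - 1) / 2 \<le> real i
     \<and> real i \<le> (real (trib m) + 2 * real (trib (m - 1)) + real (trib (m - 2)) - 3) / 2}"

definition gamma2 :: "nat \<Rightarrow> nat set" where
  "gamma2 m = {i. (- real (trib m) + 4 * real (trib (m - 1)) + real (trib (m - 2)) - 1) / 2 \<le> real i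
     \<and> real i \<le> (real (trib m) + 2 * real (trib (m - 1)) - real (trib (m - 2)) - 3) / 2}"

definition gamma3 :: "nat \<Rightarrow> nat set" where
  "gamma3 m = {i. (real (trib m) + real (trib (m - 2)) - 1) / 2 \<le> real i
     \<and> real i \<le> (- real (trib m) + 4 * real (trib (m - 1)) + real (trib (m - 2)) - 3) / 2}"

definition theta1 :: "nat \<Rightarrow> real" where
  "theta1 m = (real (trib m) + real (trib (m - 2)) - 1) / 2"

definition theta2 :: "nat \<Rightarrow> real" where
  "theta2 m = (- 5 * real (trib m) + 10 * real (trib (m - 1)) + 3 * real (trib (m - 2)) - 1) / 2"

definition theta3 :: "nat \<Rightarrow> real" where
  "theta3 m = (- real (trib m) + 6 * real (trib (m - 1)) - 3 * real (trib (m - 2)) - 1) / 2"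

definition eta1 :: "nat \<Rightarrow> real" where
  "eta1 m = - 2 * real (trib m) + 5 * real (trib (m - 1))"

definition theta4 :: "nat \<Rightarrow> real" where
  "theta4 m = (- real (trib m) + 4 * real (trib (m - 1)) + real (trib (m - 2)) - 1) / 2"

lemma subst_word_append: "subst_word (u @ v) = subst_word u @ subst_word v"
  by (simp add: subst_word_def)

lemma subst_word_pow_append: "(subst_word ^^ m) (u @ v) = (subst_word ^^ m) u @ (subst_word ^^ m) v"
  by (induction m) (simp_all add: subst_word_append)

lemma subst_word_pow_rec:
  "(subst_word ^^ (m + 3)) [A] =
     (subst_word ^^ (m + 2)) [A] @ (subst_word ^^ (m + 1)) [A] @ (subst_word ^^ m) [A]"
proof -
  have s: "(subst_word ^^ (m + k)) [A] = (subst_word ^^ m) ((subst_word ^^ k) [A])" for k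
    by (simp add: funpow_add)
  have 1: "(subst_word ^^ 1) [A] = [A, B]" and 2: "(subst_word ^^ 2) [A] = [A, B] @ [A, C]"
    and 3: "(subst_word ^^ 3) [A] = ([A, B] @ [A, C]) @ [A, B] @ [A]"
    by (simp_all add: subst_word_def numeral_eq_Suc)
  show ?thesis
    unfolding s 1 2 3 subst_word_pow_append by simp
qed

lemma trib_0: "trib 0 = 1" and trib_1: "trib 1 = 2" and trib_2: "trib 2 = 4"
  by (simp_all add: trib_def subst_word_def numeral_eq_Suc)

lemma trib_rec: "trib (m + 3) = trib (m + 2) + trib (m + 1) + trib m"
  unfolding trib_def subst_word_pow_rec by simp

lemma odd_trib_add: "odd (trib (m + 2) + trib m)"
proof (induction m)
  case 0
  have "trib (0 + 2) + trib 0 = 5" unfolding add_0 trib_0 trib_2 by simp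
  then show ?case by (metis odd_numeral)
next
  case (Suc m)
  have "trib (Suc m + 2) = trib (m + 2) + trib (m + 1) + trib m"
    using trib_rec[of m] by (simp add: numeral_eq_Suc)
  then have "trib (Suc m + 2) + trib (Suc m) = trib (m + 2) + trib m + 2 * trib (m + 1)" by simp
  then show ?case using Suc by (metis dvd_add_left_iff dvd_triv_left)
qed

lemma subst_nonempty: "subst x \<noteq> []"
  by (cases x) simp_all

lemma subst_stream_shift: "subst_stream (u @- s) = subst_word u @- subst_stream s"
proof (induction u)
  case (Cons x u)
  have "subst_stream ((x # u) @- s) = subst x @- subst_stream (u @- s)"
    by (simp add: subst_stream_def flat_unfold subst_nonempty)
  with Cons show ?case by (simp add: subst_word_def)
qed (simp add: subst_word_def)

lemma subst_word_pow_Suc: "\<exists>v. (subst_word ^^ Suc k) [A] = (subst_word ^^ k) [A] @ v"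
proof -
  have "(subst_word ^^ Suc k) [A] = (subst_word ^^ k) ([A] @ [B])"
    by (simp add: funpow_Suc_right subst_word_def del: funpow.simps)
  then show ?thesis unfolding subst_word_pow_append by blast
qed

lemma subst_word_pow_prefix:
  assumes "k \<le> l"
  shows "\<exists>v. (subst_word ^^ l) [A] = (subst_word ^^ k) [A] @ v"
  using assms
proof (induction l rule: dec_induct)
  case (step l)
  then show ?case using subst_word_pow_Suc[of l] by (metis append.assoc)
qed simp

lemma trib_gt: "k < trib k"
proof (induction k)
  case 0 show ?case by (simp add: trib_0)
next
  case (Suc k)
  have "(subst_word ^^ Suc k) [A] = (subst_word ^^ k) [A] @ (subst_word ^^ k) [B]"
    using subst_word_pow_append[of k "[A]" "[B]"]
    by (simp add: funpow_Suc_right subst_word_def del: funpow.simps)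
  moreover have "u \<noteq> [] \<Longrightarrow> (subst_word ^^ k) u \<noteq> []" for u k
    by (induction k) (auto simp: subst_word_def subst_nonempty neq_Nil_conv)
  ultimately have "trib (Suc k) > trib k" by (simp add: trib_def del: funpow.simps)
  with Suc show ?case by simp
qed

lemma fixed_point_prefix:
  assumes "shd s = A" "subst_stream s = s"
  shows "\<exists>r. s = (subst_word ^^ k) [A] @- r"
proof (induction k)
  case 0
  show ?case using assms(1) by (intro exI[of _ "stl s"]) (simp, metis stream.collapse)
next
  case (Suc k)
  then obtain r where "s = (subst_word ^^ k) [A] @- r" by blast
  then have "s = (subst_word ^^ Suc k) [A] @- subst_stream r"
    using assms(2) subst_stream_shift by simp
  then show ?case by blast
qed

lemma stream_eqI_snth: "(\<And>n. s !! n = r !! n) \<Longrightarrow> s = r"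
  by (metis ext stream_smap_nats)

lemma tribonacci_ex1: "\<exists>!s. shd s = A \<and> subst_stream s = s"
proof (rule ex_ex1I)
  define u where "u = smap (\<lambda>i. (subst_word ^^ i) [A] ! i) nats"
  have nth: "(subst_word ^^ k) [A] ! i = u !! i" if "i < trib k" for i k
  proof (cases "i \<le> k")
    case True
    then show ?thesis using subst_word_pow_prefix[OF True] trib_gt[of i]
      by (auto simp: u_def trib_def nth_append)
  next
    case False
    then have "k \<le> i" by simp
    then show ?thesis using subst_word_pow_prefix[of k i] that
      by (auto simp: u_def trib_def nth_append)
  qed
  have pre: "u = (subst_word ^^ k) [A] @- sdrop (trib k) u" for k
  proof -
    have "stake (trib k) u = (subst_word ^^ k) [A]"
      by (rule nth_equalityI) (simp_all add: nth trib_def)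
    then show ?thesis by (metis stake_sdrop)
  qed
  have "subst_stream u = u"
  proof (rule stream_eqI_snth)
    fix n
    have eq: "subst_stream u = (subst_word ^^ Suc n) [A] @- subst_stream (sdrop (trib n) u)"
      using pre[of n] subst_stream_shift by (metis funpow.simps(2) comp_apply)
    have "n < trib (Suc n)" using trib_gt[of "Suc n"] by simp
    then show "subst_stream u !! n = u !! n"
      unfolding eq using nth[of n "Suc n"] by (simp add: trib_def del: funpow.simps)
  qed
  moreover have "shd u = A" by (simp add: u_def)
  ultimately show "\<exists>s. shd s = A \<and> subst_stream s = s" by blast
next
  fix s r
  assume s: "shd s = A \<and> subst_stream s = s" and r: "shd r = A \<and> subst_stream r = r"
  show "s = r"
  proof (rule stream_eqI_snth)
    fix n
    show "s !! n = r !! n"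
      using fixed_point_prefix[of s n] fixed_point_prefix[of r n] s r trib_gt[of n]
      unfolding trib_def by (metis shift_snth_less)
  qed
qed

lemma tribonacci_fixed_point: "shd tribonacci = A" "subst_stream tribonacci = tribonacci"
  using theI'[OF tribonacci_ex1] unfolding tribonacci_def by auto

end

theory Submission
  imports Defs
begin

text \<open>A maximal match between two positions of the Tribonacci word starts with \<open>A\<close>, and so does the
  block following each copy; hence it is the image under the substitution of a shorter maximal match,
  extended by one letter \<open>A\<close>. Descending to the empty match, every maximal match of level \<open>k\<close> is an
  occurrence of one and the same palindromic prefix, of length \<open>pal_len k\<close>, with
  \<open>2 pal_len k + 3 = trib (k + 1) + trib (k - 1)\<close>. Since \<open>pal_len k < trib k + trib (k - 1)\<close>, the period
  of a square is the length of the \<open>k\<close>-th image of a single letter. The intervals \<open>\<Gamma>\<close> have endpoints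
  built from \<open>pal_len\<close>, and for \<open>n\<close> in \<open>\<Gamma>\<^sub>3\<close> of index \<open>m\<close> the squares ending at \<open>n\<close> are those lying
  behind the prefix of length \<open>t = trib (m - 1)\<close>, which correspond to the squares ending at \<open>n - t\<close>,
  together with a single square, of period \<open>trib (m - 4)\<close>, straddling position \<open>t\<close> when
  \<open>n < t + 2 trib (m - 4)\<close>.\<close>

subsection \<open>Matches and desubstitution\<close>

text \<open>Positions are counted from \<open>0\<close> here, so a square starting at \<open>s\<close> with period \<open>p\<close> ends at
  position \<open>s + 2 p\<close> in the numbering from \<open>1\<close>.\<close>

definition tr :: "nat \<Rightarrow> letter" where
  "tr i = tribonacci !! i"

definition phi :: "nat \<Rightarrow> nat" where
  "phi i = length (subst_word (stake i tribonacci))"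

section \<open>Cutting the fixed point into blocks, the images of its letters\<close>

lemma subst_stream_SCons: "subst_stream (x ## s) = subst x @- subst_stream s"
  using subst_stream_shift[of "[x]" s] by (simp add: subst_word_def)

lemma shd_subst_stream: "shd (subst_stream s) = A"
proof -
  have "shd (subst_stream (x ## r)) = A" for x r
    by (cases x) (simp_all add: subst_stream_SCons)
  then show ?thesis by (metis stream.collapse)
qed

text \<open>The fixed point is the image of its prefix of length \<open>i\<close> followed by the
  image of the rest, so \<open>phi i\<close> is where the block of the letter at position
  \<open>i\<close> starts.\<close>

lemma tr_phi_add: "tr (phi i + y) = subst_stream (sdrop i tribonacci) !! y"
proof -
  have "tribonacci = subst_word (stake i tribonacci) @- subst_stream (sdrop i tribonacci)"
    by (metis stake_sdrop subst_stream_shift tribonacci_fixed_point(2))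
  then have "tr (phi i + y)
      = (subst_word (stake i tribonacci) @- subst_stream (sdrop i tribonacci)) !! (phi i + y)"
    unfolding tr_def by simp
  then show ?thesis
    by (simp add: phi_def shift_snth_ge)
qed

lemma sdrop_tr: "sdrop i tribonacci = tr i ## sdrop (Suc i) tribonacci"
  by (metis sdrop_simps(1,2) stream.collapse tr_def sdrop.simps(2) sdrop_stl)

lemma tr_phi: "tr (phi i) = A"
  using tr_phi_add[of i 0] by (simp add: shd_subst_stream)

lemma phi_0: "phi 0 = 0"
  by (simp add: phi_def subst_word_def)

lemma tr_0: "tr 0 = A"
  using tr_phi[of 0] by (simp add: phi_0)

lemma phi_Suc: "phi (Suc i) = phi i + length (subst (tr i))"
  unfolding phi_def stake_Suc subst_word_append by (simp add: subst_word_def tr_def)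

text \<open>One function serves both ends of a block: it gives the last letter of
  \<open>subst x\<close>, and also the letter after the leading \<open>A\<close>, which for
  \<open>C\<close> is the \<open>A\<close> opening the next block.\<close>

fun next_letter :: "letter \<Rightarrow> letter" where
  "next_letter A = B"
| "next_letter B = C"
| "next_letter C = A"

lemma next_letter_eq_iff: "next_letter x = next_letter y \<longleftrightarrow> x = y"
  by (cases x; cases y) simp_all

lemma tr_Suc_phi: "tr (Suc (phi i)) = next_letter (tr i)"
  using tr_phi_add[of i 1] shd_subst_stream[of "sdrop (Suc i) tribonacci"]
  by (cases "tr i") (simp_all add: sdrop_tr[of i] subst_stream_SCons)

lemma tr_pred_phi_Suc: "tr (phi (Suc i) - 1) = next_letter (tr i)"
  using tr_Suc_phi[of i] tr_phi[of i] by (cases "tr i") (simp_all add: phi_Suc)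

lemma strict_mono_phi: "strict_mono phi"
  by (rule strict_mono_Suc_iff[THEN iffD2]) (simp add: phi_Suc subst_nonempty)

lemma phi_add_ge: "phi i + d \<le> phi (i + d)"
proof (induction d)
  case (Suc d)
  have "phi (i + d) < phi (i + Suc d)" by (rule strict_monoD[OF strict_mono_phi]) simp
  with Suc show ?case by simp
qed simp

lemma phi_cases:
  obtains k where "i = phi k" | k where "i = Suc (phi k)" "tr k \<noteq> C"
proof -
  have "(\<exists>k. i = phi k) \<or> (\<exists>k. i = Suc (phi k) \<and> tr k \<noteq> C)"
  proof (induction i)
    case 0
    then show ?case using phi_0 by metis
  next
    case (Suc i)
    then consider k where "i = phi k" | k where "i = Suc (phi k)" "tr k \<noteq> C" by blast
    then show ?case
    proof cases
      case 1
      show ?thesis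
      proof (cases "tr k = C")
        case True
        then have "Suc i = phi (Suc k)" using 1 by (simp add: phi_Suc)
        then show ?thesis by blast
      qed (use 1 in blast)
    next
      case 2
      then have "Suc i = phi (Suc k)" by (cases "tr k") (simp_all add: phi_Suc)
      then show ?thesis by blast
    qed
  qed
  then show thesis using that by blast
qed

text \<open>The second letter of a block of length two is \<open>B\<close> or \<open>C\<close>, so
  the letters alone reveal the block boundaries.\<close>

lemma tr_eq_A_iff: "tr i = A \<longleftrightarrow> (\<exists>k. i = phi k)"
proof (cases i rule: phi_cases)
  case (1 k)
  then show ?thesis using tr_phi by blast
next
  case (2 k)
  then have "tr i \<noteq> A" using tr_Suc_phi[of k] by (cases "tr k") simp_all
  then show ?thesis using tr_phi by auto
qed

lemma tr_eq_A_or_Suc: "tr i = A \<or> tr (Suc i) = A"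
proof (cases i rule: phi_cases)
  case (1 k)
  then show ?thesis using tr_phi by simp
next
  case (2 k)
  then have "Suc i = phi (Suc k)" by (cases "tr k") (simp_all add: phi_Suc)
  then show ?thesis using tr_phi by simp
qed

section \<open>Matches and their images\<close>

text \<open>The copies may overlap: \<open>agree s (s + p) l\<close> says that the factor of length
  \<open>l + p\<close> starting at \<open>s\<close> has period \<open>p\<close>.\<close>

definition agree :: "nat \<Rightarrow> nat \<Rightarrow> nat \<Rightarrow> bool" where
  "agree i j l \<longleftrightarrow> (\<forall>x<l. tr (i + x) = tr (j + x))"

text \<open>Equal letters have blocks of equal length; the additive form avoids subtraction of
  naturals.\<close>

lemma agree_phi_diff:
  assumes "agree i j l"
  shows "phi (i + l) + phi j = phi (j + l) + phi i"
  using assms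
proof (induction l)
  case (Suc l)
  then have "tr (i + l) = tr (j + l)" by (simp add: agree_def)
  moreover have "agree i j l" using Suc.prems by (simp add: agree_def)
  ultimately show ?case using Suc.IH by (simp add: phi_Suc)
qed simp

text \<open>The extra letter is the first letter \<open>A\<close> of the block following the common part.\<close>

lemma agree_phi:
  assumes "agree i j l"
  shows "agree (phi i) (phi j) (Suc (phi (i + l) - phi i))"
  using assms
proof (induction l)
  case 0
  then show ?case by (simp add: agree_def tr_phi)
next
  case (Suc l)
  have ag: "agree i j l" and eq: "tr (i + l) = tr (j + l)"
    using Suc.prems by (simp_all add: agree_def)
  define d where "d = phi (i + l) - phi i"
  have di: "phi (i + l) = phi i + d" using phi_add_ge[of i l] by (simp add: d_def)
  have dj: "phi (j + l) = phi j + d" using agree_phi_diff[OF ag] di by simp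
  have old: "tr (phi i + x) = tr (phi j + x)" if "x \<le> d" for x
    using Suc.IH[OF ag] that by (simp add: agree_def d_def)
  have new1: "tr (phi i + Suc d) = tr (phi j + Suc d)"
    using tr_Suc_phi[of "i + l"] tr_Suc_phi[of "j + l"] eq by (simp add: di dj)
  have new2: "tr (phi (Suc (i + l))) = tr (phi (Suc (j + l)))" by (simp add: tr_phi)
  show ?case
    unfolding agree_def
  proof (intro allI impI)
    fix x assume x: "x < Suc (phi (i + Suc l) - phi i)"
    have len: "length (subst (tr (i + l))) \<le> 2" by (cases "tr (i + l)") simp_all
    consider "x \<le> d" | "x = Suc d" | "x = Suc (Suc d)" "length (subst (tr (i + l))) = 2"
      using x len by (fastforce simp: phi_Suc di)
    then show "tr (phi i + x) = tr (phi j + x)"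
    proof cases
      case 3
      then show ?thesis using new2 eq by (simp add: phi_Suc di dj)
    qed (use old new1 in auto)
  qed
qed

text \<open>Blocks of different letters share their leading \<open>A\<close> and differ right after
  it, by injectivity of \<open>next_letter\<close>. So the image of a match is prolonged by exactly
  one letter.\<close>

lemma disagree_phi:
  assumes "agree i j l" and "tr (i + l) \<noteq> tr (j + l)"
  shows "tr (phi i + Suc (phi (i + l) - phi i)) \<noteq> tr (phi j + Suc (phi (i + l) - phi i))"
proof -
  define d where "d = phi (i + l) - phi i"
  have di: "phi (i + l) = phi i + d" using phi_add_ge[of i l] by (simp add: d_def)
  have dj: "phi (j + l) = phi j + d" using agree_phi_diff[OF assms(1)] di by simp
  show ?thesis
    using tr_Suc_phi[of "i + l"] tr_Suc_phi[of "j + l"] assms(2)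
    by (simp add: di dj next_letter_eq_iff)
qed

lemma ex_least_disagreement:
  assumes "tr (i + x) \<noteq> tr (j + x)"
  obtains l where "agree i j l" "tr (i + l) \<noteq> tr (j + l)"
proof -
  define l where "l = (LEAST x. tr (i + x) \<noteq> tr (j + x))"
  have "tr (i + l) \<noteq> tr (j + l)" unfolding l_def by (rule LeastI[of _ x]) (rule assms)
  moreover have "agree i j l" unfolding agree_def l_def using not_less_Least by blast
  ultimately show thesis using that by blast
qed

text \<open>Infinite descent: an eventual period, read from the start of a block, desubstitutes to a
  smaller positive eventual period.\<close>

lemma not_eventually_periodic:
  assumes "0 < p"
  shows "\<exists>x. tr (s + x) \<noteq> tr (s + p + x)"
  using assms
proof (induction p arbitrary: s rule: less_induct)
  case (less p)
  show ?case
  proof (rule ccontr)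
    assume "\<not> ?thesis"
    then have per: "tr (s + x) = tr (s + p + x)" for x by blast
    obtain s' where s': "s \<le> s'" "tr s' = A"
      using tr_eq_A_or_Suc[of s] by (metis le_refl Suc_n_not_le_n nat_le_linear)
    have "s \<le> phi s'" using s'(1) phi_add_ge[of 0 s'] by (simp add: phi_0)
    then have per': "tr (phi s' + x) = tr (phi s' + p + x)" for x
      using per[of "phi s' - s + x"] by (simp add: algebra_simps)
    obtain j where j: "phi s' + p = phi j"
      using per'[of 0] tr_phi[of s'] tr_eq_A_iff[of "phi s' + p"] by auto
    have "s' < j" using j less.prems strict_mono_less[OF strict_mono_phi, of s' j] by simp
    then obtain q where q: "j = s' + q" "0 < q" using less_imp_add_positive by blast
    \<comment> \<open>The first of the \<open>q\<close> blocks has two letters because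
      \<open>tr s' = A\<close>; the others have at least one.\<close>
    have "q < p"
      using phi_add_ge[of "Suc s'" "q - 1"] q j s'(2) by (simp add: phi_Suc)
    then obtain x where "tr (s' + x) \<noteq> tr (j + x)"
      using less.IH[of q s'] q by auto
    then obtain l where "agree s' j l" "tr (s' + l) \<noteq> tr (j + l)"
      by (rule ex_least_disagreement)
    from disagree_phi[OF this] show False using per' j by metis
  qed
qed

section \<open>Maximal matches\<close>

text \<open>A match starting at position 0 counts as maximal to the left, there being no earlier
  letter.\<close>

definition max_agree :: "nat \<Rightarrow> nat \<Rightarrow> nat \<Rightarrow> bool" where
  "max_agree i j l \<longleftrightarrow> agree i j l \<and> tr (i + l) \<noteq> tr (j + l) \<and> (0 < i \<longrightarrow> tr (i - 1) \<noteq> tr (j - 1))"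

text \<open>Extension to the left stops at position 0 at the latest; extension to the right stops
  because the word is not eventually periodic.\<close>

lemma max_agree_extend:
  assumes "agree s (s + p) l" and "0 < p"
  obtains i l' where "i \<le> s" "s + l \<le> i + l'" "max_agree i (i + p) l'"
proof -
  define P where "P j \<longleftrightarrow> j \<le> s \<and> (\<forall>x. j \<le> x \<and> x < s \<longrightarrow> tr x = tr (x + p))" for j
  define i where "i = Least P"
  have "P s" by (auto simp: P_def)
  then have "P i" unfolding i_def by (rule LeastI)
  then have i: "i \<le> s" "\<And>x. i \<le> x \<Longrightarrow> x < s \<Longrightarrow> tr x = tr (x + p)"
    unfolding P_def by blast+
  have left: "tr (i - 1) \<noteq> tr (i + p - 1)" if "0 < i"
  proof
    assume eq: "tr (i - 1) = tr (i + p - 1)"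
    have "tr x = tr (x + p)" if x: "i - 1 \<le> x" "x < s" for x
    proof (cases "i \<le> x")
      case False
      then have "x = i - 1" "x + p = i + p - 1" using x \<open>0 < i\<close> by linarith+
      then show ?thesis using eq by metis
    qed (use i(2) x in blast)
    moreover have "i - 1 \<le> s" using i(1) by simp
    ultimately have "P (i - 1)" unfolding P_def by blast
    then have "i \<le> i - 1" unfolding i_def by (rule Least_le)
    with \<open>0 < i\<close> show False by simp
  qed
  obtain x where "tr (i + x) \<noteq> tr (i + p + x)"
    using not_eventually_periodic[OF assms(2)] by blast
  then obtain l' where l': "agree i (i + p) l'" "tr (i + l') \<noteq> tr (i + p + l')"
    by (rule ex_least_disagreement)
  have "s + l \<le> i + l'"
  proof (rule ccontr)
    assume less: "\<not> s + l \<le> i + l'"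
    show False
    proof (cases "i + l' < s")
      case True
      then show False using i(2)[of "i + l'"] l'(2) by (simp add: algebra_simps)
    next
      case False
      then have "i + l' = s + (i + l' - s)" "i + p + l' = s + p + (i + l' - s)" "i + l' - s < l"
        using less by linarith+
      then show False using assms(1) l'(2) unfolding agree_def by metis
    qed
  qed
  moreover have "max_agree i (i + p) l'" using l' left by (simp add: max_agree_def)
  ultimately show thesis using that i(1) by blast
qed

text \<open>If the copies started with the second letter of a block, both would be preceded by
  \<open>A\<close>, against maximality. So both start blocks, and the first mismatch of the
  preimages determines the length.\<close>

lemma max_agree_desubst:
  assumes max: "max_agree i j l" and "i < j" and "0 < l"
  obtains i' j' l' where "i = phi i'" "j = phi j'" "l = Suc (phi (i' + l') - phi i')"
    "max_agree i' j' l'"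
proof -
  have ag: "agree i j l" and end_ne: "tr (i + l) \<noteq> tr (j + l)"
    and left: "0 < i \<Longrightarrow> tr (i - 1) \<noteq> tr (j - 1)"
    using max by (auto simp: max_agree_def)
  have eq: "tr i = tr j" using ag \<open>0 < l\<close> by (auto simp: agree_def dest: spec[of _ 0])
  have "tr i = A"
  proof (rule ccontr)
    assume ne: "tr i \<noteq> A"
    then have "0 < i" using tr_0 by (cases i) auto
    moreover have "tr (i - 1) = A" "tr (j - 1) = A"
      using tr_eq_A_or_Suc[of "i - 1"] tr_eq_A_or_Suc[of "j - 1"] ne eq \<open>0 < i\<close> \<open>i < j\<close> by auto
    ultimately show False using left by simp
  qed
  then obtain i' j' where i': "i = phi i'" and j': "j = phi j'"
    using eq by (metis tr_eq_A_iff)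
  \<comment> \<open>Preimages agreeing on \<open>l\<close> letters would have images agreeing on
    more than \<open>l\<close> letters.\<close>
  have "\<exists>x. tr (i' + x) \<noteq> tr (j' + x)"
  proof (rule ccontr)
    assume "\<not> ?thesis"
    then have "agree i' j' l" by (simp add: agree_def)
    from agree_phi[OF this] have "tr (phi i' + l) = tr (phi j' + l)"
      using phi_add_ge[of i' l] by (simp add: agree_def)
    with end_ne i' j' show False by simp
  qed
  then obtain l' where l': "agree i' j' l'" "tr (i' + l') \<noteq> tr (j' + l')"
    using ex_least_disagreement by blast
  define d where "d = Suc (phi (i' + l') - phi i')"
  have "agree i j d" and "tr (i + d) \<noteq> tr (j + d)"
    using agree_phi[OF l'(1)] disagree_phi[OF l'] by (simp_all add: d_def i' j')
  then have "l = d"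
    using ag end_ne unfolding agree_def by (metis nat_neq_iff)
  have "i' < j'"
    using \<open>i < j\<close> strict_mono_less[OF strict_mono_phi] by (simp add: i' j')
  have "tr (i' - 1) \<noteq> tr (j' - 1)" if "0 < i'"
  proof -
    have "phi 0 < phi i'" using that by (rule strict_monoD[OF strict_mono_phi])
    then have "0 < i" by (simp add: i' phi_0)
    then show ?thesis
      using left tr_pred_phi_Suc[of "i' - 1"] tr_pred_phi_Suc[of "j' - 1"] that \<open>i' < j'\<close>
      by (auto simp: i' j')
  qed
  then have "max_agree i' j' l'" using l' by (simp add: max_agree_def)
  then show thesis using that i' j' \<open>l = d\<close> d_def by blast
qed

text \<open>The lengths 0, 1, 3, 7, 14, ... of the palindromic prefixes, each being the image of the
  preceding one followed by an \<open>A\<close>.\<close>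

primrec pal_len :: "nat \<Rightarrow> nat" where
  "pal_len 0 = 0"
| "pal_len (Suc k) = Suc (phi (pal_len k))"

declare pal_len.simps(2) [simp del]

text \<open>The case \<open>phi 0 = 0\<close> of the general facts on images: \<open>phi\<close> is
  additive along an occurrence of a prefix.\<close>

lemma agree_prefix_phi:
  assumes "agree i 0 l"
  shows "phi (i + l) = phi i + phi l" and "agree (phi i) 0 (Suc (phi l))"
proof -
  show *: "phi (i + l) = phi i + phi l" using agree_phi_diff[OF assms] by (simp add: phi_0)
  show "agree (phi i) 0 (Suc (phi l))" using agree_phi[OF assms] by (simp add: * phi_0)
qed

lemma agree_pal_len: "agree ((phi ^^ k) i) 0 (pal_len k)"
proof (induction k)
  case 0
  show ?case by (simp add: agree_def)
next
  case (Suc k)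
  then show ?case using agree_prefix_phi(2) by (simp add: pal_len.simps(2))
qed

text \<open>Desubstitution shortens a nonempty maximal match, so the descent ends at an empty one
  after \<open>k\<close> steps. On the way back each match occurs as a prefix of the word, hence its
  length depends on \<open>k\<close> alone.\<close>

lemma max_agree_structure:
  assumes "max_agree i j l" and "i < j"
  shows "\<exists>k i' j'. i = (phi ^^ k) i' \<and> j = (phi ^^ k) j' \<and> i' < j' \<and> l = pal_len k"
  using assms
proof (induction l arbitrary: i j rule: less_induct)
  case (less l)
  show ?case
  proof (cases "l = 0")
    case True
    have "i = (phi ^^ 0) i \<and> j = (phi ^^ 0) j \<and> i < j \<and> l = pal_len 0" using less.prems True by simp
    then show ?thesis by blast
  next
    case False
    then obtain i1 j1 l1 where 1: "i = phi i1" "j = phi j1" "l = Suc (phi (i1 + l1) - phi i1)"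
      "max_agree i1 j1 l1"
      using max_agree_desubst less.prems by (metis neq0_conv)
    have "l1 < l" using 1(3) phi_add_ge[of i1 l1] by simp
    moreover have "i1 < j1"
      using less.prems(2) strict_mono_less[OF strict_mono_phi] by (simp add: 1)
    ultimately obtain k i' j' where 2: "i1 = (phi ^^ k) i'" "j1 = (phi ^^ k) j'" "i' < j'"
      "l1 = pal_len k"
      using less.IH[OF _ 1(4)] by blast
    have "phi (i1 + l1) = phi i1 + phi l1"
      using agree_prefix_phi(1)[OF agree_pal_len[of k i']] by (simp add: 2)
    then have "i = (phi ^^ Suc k) i' \<and> j = (phi ^^ Suc k) j' \<and> i' < j' \<and> l = pal_len (Suc k)"
      using 1 2 by (simp add: pal_len.simps(2))
    then show ?thesis by blast
  qed
qed

subsection \<open>Lengths of images and palindromic prefixes\<close>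

definition sub_len :: "nat \<Rightarrow> letter \<Rightarrow> nat" where
  "sub_len k x = length ((subst_word ^^ k) [x])"

lemma sub_len_0: "sub_len 0 x = 1"
  by (simp add: sub_len_def)

lemma sub_len_A: "sub_len k A = trib k"
  by (simp add: sub_len_def trib_def)

lemma sub_len_Suc: "sub_len (Suc k) x = length ((subst_word ^^ k) (subst x))"
  by (simp add: sub_len_def subst_word_def funpow_Suc_right del: funpow.simps)

lemma sub_len_Suc_B: "sub_len (Suc k) B = trib k + sub_len k C"
  using subst_word_pow_append[of k "[A]" "[C]"] by (simp add: sub_len_Suc) (simp add: sub_len_def trib_def)

lemma sub_len_Suc_C: "sub_len (Suc k) C = trib k"
  by (simp add: sub_len_Suc) (simp add: trib_def)

lemma trib_Suc: "trib (Suc k) = trib k + sub_len k B"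
  using subst_word_pow_append[of k "[A]" "[B]"]
  by (simp flip: sub_len_A add: sub_len_Suc) (simp add: sub_len_def)

text \<open>The inequalities feed each other: that between \<open>C\<close> and \<open>B\<close> at
  level \<open>k\<close> gives that between \<open>B\<close> and \<open>A\<close> at level
  \<open>k + 1\<close>, and that between \<open>B\<close> and \<open>A\<close> gives the last one at
  the next level.\<close>

lemma sub_len_bounds: "sub_len k C \<le> sub_len k B \<and> sub_len k B \<le> trib k \<and> trib k \<le> 2 * sub_len k C"
proof (induction k)
  case 0
  then show ?case by (simp add: sub_len_0 trib_0)
next
  case (Suc k)
  then show ?case by (simp add: sub_len_Suc_B sub_len_Suc_C trib_Suc[of k])
qed

lemma sub_len_ge: "sub_len k C \<le> sub_len k x"
  using sub_len_bounds[of k] by (cases x) (auto simp: sub_len_A)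

lemma trib_pos: "0 < trib k"
  using trib_gt[of k] by simp

text \<open>The positions \<open>(phi ^^ k) i\<close> cut the word into blocks of level
  \<open>k\<close>, the \<open>k\<close>-th images of its letters.\<close>

lemma phi_pow_Suc: "(phi ^^ k) (Suc i) = (phi ^^ k) i + sub_len k (tr i)"
proof (induction k arbitrary: i)
  case 0
  then show ?case by (simp add: sub_len_0)
next
  case (Suc k)
  have "(phi ^^ Suc k) (Suc i) = (phi ^^ k) (phi (Suc i))"
    by (simp add: funpow_swap1)
  moreover have "(phi ^^ Suc k) i = (phi ^^ k) (phi i)"
    by (simp add: funpow_swap1)
  ultimately show ?case
    using tr_phi[of i] tr_Suc_phi[of i] sub_len_Suc_B[of k] sub_len_Suc_C[of k] trib_Suc[of k]
    by (cases "tr i") (simp_all add: phi_Suc Suc.IH sub_len_A del: funpow.simps)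
qed

lemma phi_pow_0: "(phi ^^ k) 0 = 0"
  by (induction k) (simp_all add: phi_0)

lemma phi_pow_1: "(phi ^^ k) (Suc 0) = trib k"
  by (simp add: phi_pow_Suc phi_pow_0 tr_0 sub_len_A)

lemma phi_pow_trib: "(phi ^^ k) (trib l) = trib (k + l)"
  by (simp flip: phi_pow_1 add: funpow_add)

lemma strict_mono_phi_pow: "strict_mono (phi ^^ k)"
  by (induction k) (auto simp: strict_mono_def strict_mono_less[OF strict_mono_phi])

lemma strict_mono_trib: "strict_mono trib"
proof (rule strict_mono_Suc_iff[THEN iffD2], rule allI)
  fix k
  have "0 < sub_len k B" using sub_len_bounds[of k] trib_pos[of k] by simp
  then show "trib k < trib (Suc k)" by (simp add: trib_Suc)
qed

text \<open>In the induction, \<open>phi\<close> is applied to \<open>trib k + pal_len k\<close>,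
  where it is additive because the prefix of length \<open>pal_len k\<close> recurs at
  \<open>trib k\<close>.\<close>

lemma pal_len_add_trib: "pal_len (Suc k) = pal_len k + trib k"
proof (induction k)
  case 0
  then show ?case by (simp add: phi_0 trib_0 pal_len.simps(2))
next
  case (Suc k)
  have "agree (trib k) 0 (pal_len k)"
    using agree_pal_len[of k "Suc 0"] by (simp add: phi_pow_1)
  from agree_prefix_phi(1)[OF this]
  have "phi (trib k + pal_len k) = trib (Suc k) + phi (pal_len k)"
    using phi_pow_trib[of 1 k] by simp
  then show ?case using Suc.IH by (simp add: add.commute pal_len.simps(2))
qed

lemma trib_Suc3: "trib (Suc (Suc (Suc k))) = trib (Suc (Suc k)) + trib (Suc k) + trib k"
  using trib_rec[of k] by (simp add: numeral_eq_Suc)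

text \<open>The source of the halves in the endpoints of the intervals \<Gamma>.\<close>

lemma pal_len_closed: "2 * pal_len (Suc k) + 3 = trib (Suc (Suc k)) + trib k"
proof (induction k)
  case 0
  then show ?case using trib_2 by (simp add: phi_0 trib_0 numeral_2_eq_2 pal_len.simps(2))
next
  case (Suc k)
  then show ?case using pal_len_add_trib[of "Suc k"] trib_Suc3[of k] by simp
qed

text \<open>Combine the closed form with \<open>trib (k + 2) \<le> 2 * trib (k + 1)\<close>. The
  bound is the least total length of two adjacent blocks of level \<open>k + 1\<close>: one of them
  is an image of \<open>A\<close>, the other at least as long as that of \<open>C\<close>.\<close>

lemma pal_len_upper: "pal_len (Suc k) < trib (Suc k) + trib k"
  using pal_len_closed[of k] sub_len_bounds[of "Suc k"] trib_Suc[of "Suc k"]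
  by simp

text \<open>Extended maximally, the match joins two block starts of some level, which is positive
  since an empty match cannot contain \<open>p\<close> letters. Two adjacent blocks are longer than
  the match, so \<open>p\<close> is the length of a single block.\<close>

lemma long_agree_structure:
  assumes "agree s (s + p) l" and "0 < p" and "p \<le> l"
  obtains k i where "p = sub_len (Suc k) (tr i)" "(phi ^^ Suc k) i \<le> s"
    "s + l \<le> (phi ^^ Suc k) i + pal_len (Suc k)"
proof -
  obtain i0 l' where 1: "i0 \<le> s" "s + l \<le> i0 + l'" "max_agree i0 (i0 + p) l'"
    using max_agree_extend[OF assms(1,2)] .
  obtain k i j where 2: "i0 = (phi ^^ k) i" "i0 + p = (phi ^^ k) j" "i < j" "l' = pal_len k"
    using max_agree_structure[OF 1(3)] assms(2) by auto
  have "p \<le> l'" using 1 assms(3) by simp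
  then have "k \<noteq> 0" using assms(2) 2(4) by (cases k) auto
  then obtain k' where k': "k = Suc k'" using not0_implies_Suc by blast
  have "j = Suc i"
  proof (rule ccontr)
    assume "j \<noteq> Suc i"
    then have "Suc (Suc i) \<le> j" using 2(3) by simp
    then have "(phi ^^ k) (Suc (Suc i)) \<le> i0 + p"
      unfolding 2(2) by (simp add: strict_mono_less_eq[OF strict_mono_phi_pow])
    moreover have "(phi ^^ k) (Suc (Suc i)) = i0 + sub_len k (tr i) + sub_len k (tr (Suc i))"
      by (simp only: phi_pow_Suc 2(1))
    ultimately have "sub_len k (tr i) + sub_len k (tr (Suc i)) \<le> p" by simp
    moreover have "trib k + sub_len k C \<le> sub_len k (tr i) + sub_len k (tr (Suc i))"
      using tr_eq_A_or_Suc[of i] sub_len_ge[of k "tr i"] sub_len_ge[of k "tr (Suc i)"]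
      by (auto simp: sub_len_A)
    ultimately show False
      using \<open>p \<le> l'\<close> pal_len_upper[of k'] sub_len_Suc_C[of k'] by (simp add: 2(4) k')
  qed
  then have "p = sub_len k (tr i)" using 2 by (simp add: phi_pow_Suc)
  then show thesis using that[of k' i] 1 2 k' by simp
qed

text \<open>In particular there are no fourth powers, so the two halves of a square are always consecutive
  occurrences.\<close>

lemma no_triple_agree:
  assumes "agree s (s + p) l" and "0 < p"
  shows "l < 3 * p"
proof (cases "p \<le> l")
  case True
  obtain k i where ki: "p = sub_len (Suc k) (tr i)" "(phi ^^ Suc k) i \<le> s"
    "s + l \<le> (phi ^^ Suc k) i + pal_len (Suc k)"
    using long_agree_structure[OF assms True] .
  have "l \<le> pal_len (Suc k)" using ki(2,3) by linarith
  moreover have "pal_len (Suc k) < trib (Suc k) + trib k" by (rule pal_len_upper)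
  moreover have "trib (Suc k) \<le> 2 * trib k" "trib k \<le> p"
    using sub_len_bounds[of "Suc k"] sub_len_ge[of "Suc k" "tr i"] ki(1)
    by (simp_all add: sub_len_Suc_C)
  ultimately show ?thesis by linarith
qed (use assms in simp)

subsection \<open>Squares\<close>

definition square :: "nat \<Rightarrow> nat \<Rightarrow> bool" where
  "square s p \<longleftrightarrow> 0 < p \<and> agree s (s + p) p"

lemma agree_iff_stake:
  "agree i j l \<longleftrightarrow> stake l (sdrop i tribonacci) = stake l (sdrop j tribonacci)"
  by (simp add: agree_def list_eq_iff_nth_eq tr_def sdrop_snth)

text \<open>An inner occurrence would give the whole square the smaller of \<open>d\<close> and
  \<open>p - d\<close> as a period. This is at most half of \<open>p\<close>, so a fourth power
  would arise.\<close>

lemma square_no_inner_occurrence: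
  assumes "square s p" and "0 < d" and "d < p"
  shows "\<not> agree s (s + d) p"
proof
  assume ag: "agree s (s + d) p"
  have per: "tr (s + x) = tr (s + p + x)" if "x < p" for x
    using assms(1) that by (simp add: square_def agree_def)
  have inner: "tr (s + x) = tr (s + d + x)" if "x < p" for x
    using ag that by (simp add: agree_def)
  show False
  proof (cases "2 * d \<le> p")
    case True
    have "agree s (s + d) (2 * p - d)"
      unfolding agree_def
    proof (intro allI impI)
      fix x assume x: "x < 2 * p - d"
      show "tr (s + x) = tr (s + d + x)"
      proof (cases "x < p")
        case False
        then show ?thesis
          using x inner[of "x - p"] per[of "x - p"] per[of "d + x - p"] by (simp add: add.assoc)
      qed (use inner[of x] in simp)
    qed
    then show False using no_triple_agree[of s d] assms(2) True by fastforce
  next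
    case False
    define e where "e = p - d"
    have "agree s (s + e) (2 * p - e)"
      unfolding agree_def
    proof (intro allI impI)
      fix x assume x: "x < 2 * p - e"
      show "tr (s + x) = tr (s + e + x)"
      proof (cases "x < d")
        case True
        then show ?thesis
          using inner[of "x + e"] per[of x] assms(3) by (simp add: e_def ac_simps)
      next
        case False
        then show ?thesis
          using x inner[of "x - d"] per[of "x - d"] assms(3) by (simp add: e_def ac_simps)
      qed
    qed
    then show False using no_triple_agree[of s e "2 * p - e"] assms(3) False by (simp add: e_def)
  qed
qed

lemma occurs_at_iff:
  assumes "1 \<le> i"
  shows "occurs_at (stake l (sdrop (i - 1) tribonacci)) j \<longleftrightarrow> 1 \<le> j \<and> agree (i - 1) (j - 1) l"
  by (auto simp: occurs_at_def agree_iff_stake)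

lemma nth_occurrence_next:
  assumes "occurs_at w i" and "occurs_at w j" and "i < j"
    and "\<And>k. i < k \<Longrightarrow> k < j \<Longrightarrow> \<not> occurs_at w k"
  shows "card {k. k \<le> j \<and> occurs_at w k} = card {k. k \<le> i \<and> occurs_at w k} + 1"
proof -
  have "{k. k \<le> j \<and> occurs_at w k} = insert j {k. k \<le> i \<and> occurs_at w k}"
    using assms(1-3) assms(4) by (auto simp: le_less not_less) (meson linorder_neqE_nat)
  then show ?thesis using assms(3) by (simp add: card_insert_if)
qed

text \<open>For a fixed end the period determines the word and the index of its occurrence;
  conversely the halves of a square are consecutive occurrences, since none starts in
  between.\<close>

lemma a_eq_card_squares: "a n = card {p. \<exists>s. square s p \<and> s + 2 * p = n}"
proof -
  define word where "word p = stake p (sdrop (n - 2 * p) tribonacci)" for p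
  define idx where "idx p = card {k. k \<le> Suc (n - 2 * p) \<and> occurs_at (word p) k}" for p
  define S where "S = {p. \<exists>s. square s p \<and> s + 2 * p = n}"
  have "{(w, p). w \<noteq> [] \<and> is_factor w \<and> 1 \<le> p \<and> square_ending_at w p n}
      = (\<lambda>p. (word p, idx p)) ` S" (is "?L = ?R")
  proof
    show "?L \<subseteq> ?R"
    proof
      fix wp assume "wp \<in> ?L"
      then obtain w q i where wq: "wp = (w, q)" "w \<noteq> []" "nth_occurrence w q i"
        "nth_occurrence w (q + 1) (i + length w)" "n = i + 2 * length w - 1"
        by (auto simp: square_ending_at_def)
      have i: "1 \<le> i" "stake (length w) (sdrop (i - 1) tribonacci) = w"
        using wq(3) by (auto simp: nth_occurrence_def occurs_at_def)
      have i2: "stake (length w) (sdrop (i + length w - 1) tribonacci) = w"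
        using wq(4) by (auto simp: nth_occurrence_def occurs_at_def)
      have ni: "n - 2 * length w = i - 1" using wq(5) i(1) by simp
      have "square (i - 1) (length w)"
        using i i2 wq(2) by (simp add: square_def agree_iff_stake)
      then have "length w \<in> S" using wq(5) i(1) by (auto simp: S_def)
      moreover have "word (length w) = w" using i(2) by (simp add: word_def ni)
      moreover from this have "idx (length w) = q"
        using wq(3) i(1) by (simp add: idx_def ni nth_occurrence_def)
      ultimately show "wp \<in> ?R" using wq(1) by force
    qed
    show "?R \<subseteq> ?L"
    proof
      fix wp assume "wp \<in> ?R"
      then obtain p s where p: "wp = (word p, idx p)" "square s p" "s + 2 * p = n"
        by (auto simp: S_def)
      have s: "n - 2 * p = s" using p(3) by simp
      have len: "length (word p) = p" by (simp add: word_def)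
      have occ: "occurs_at (word p) k \<longleftrightarrow> 1 \<le> k \<and> agree s (k - 1) p" for k
        using occurs_at_iff[of "Suc s" p k] by (simp add: word_def s)
      have "0 < p" and ag: "agree s (s + p) p" using p(2) by (auto simp: square_def)
      have o1: "occurs_at (word p) (Suc s)" by (simp add: occ agree_def)
      have o2: "occurs_at (word p) (Suc s + p)" using ag by (simp add: occ)
      have none: "\<not> occurs_at (word p) k" if "Suc s < k" "k < Suc s + p" for k
        using square_no_inner_occurrence[OF p(2), of "k - Suc s"] that by (auto simp: occ)
      have "card {k. k \<le> Suc s + p \<and> occurs_at (word p) k} = idx p + 1"
        using nth_occurrence_next[OF o1 o2 _ none] \<open>0 < p\<close> by (simp add: idx_def s)
      then have "square_ending_at (word p) (idx p) n"
        unfolding square_ending_at_def nth_occurrence_def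
        using o1 o2 p(3) by (intro exI[of _ "Suc s"]) (simp add: len idx_def s)
      moreover have "1 \<le> idx p"
      proof -
        have "finite {k. k \<le> Suc s \<and> occurs_at (word p) k}" by simp
        moreover have "Suc s \<in> {k. k \<le> Suc s \<and> occurs_at (word p) k}" using o1 by simp
        ultimately show ?thesis unfolding idx_def s
          by (metis One_nat_def Suc_leI card_gt_0_iff empty_iff)
      qed
      moreover have "is_factor (word p)" using o1 by (auto simp: is_factor_def)
      moreover have "word p \<noteq> []" using len \<open>0 < p\<close> by auto
      ultimately show "wp \<in> ?L" using p(1) by simp
    qed
  qed
  moreover have "inj_on (\<lambda>p. (word p, idx p)) S"
  proof (rule inj_onI)
    fix p q assume "(word p, idx p) = (word q, idx q)"
    then have "length (word p) = length (word q)" by simp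
    then show "p = q" by (simp add: word_def)
  qed
  ultimately show ?thesis unfolding a_def S_def by (simp add: card_image)
qed

text \<open>The period is the length of block \<open>i\<close>, so adding it moves the bound from
  the start of that block to the start of the next.\<close>

lemma squareE:
  assumes "square s p"
  obtains k i where "p = sub_len (Suc k) (tr i)" "(phi ^^ Suc k) i \<le> s"
    "s + 2 * p \<le> (phi ^^ Suc k) (Suc i) + pal_len (Suc k)"
proof -
  have "agree s (s + p) p" "0 < p" using assms by (simp_all add: square_def)
  then obtain k i where "p = sub_len (Suc k) (tr i)" "(phi ^^ Suc k) i \<le> s"
    "s + p \<le> (phi ^^ Suc k) i + pal_len (Suc k)"
    using long_agree_structure[of s p p] by blast
  then show thesis using that[of k i] phi_pow_Suc[of "Suc k" i] by simp
qed

section \<open>Squares across the position \<open>trib (N + 3)\<close>\<close>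

lemma strict_mono_pal_len: "strict_mono pal_len"
  by (rule strict_mono_Suc_iff[THEN iffD2]) (simp add: pal_len_add_trib trib_pos)

text \<open>Up to level \<open>N + 3\<close> the position \<open>trib (N + 3)\<close> is a block
  boundary, preceded by 1, 2 or 4 blocks at the levels \<open>N + 3\<close>, \<open>N + 2\<close>,
  \<open>N + 1\<close>. Low levels end too early, high ones too late; what remains is the block of
  \<open>C\<close> at level \<open>N + 1\<close>.\<close>

lemma straddling_square_period:
  assumes sq: "square s p" and s: "s < trib (N + 3)"
    and lower: "trib (N + 3) + pal_len N < s + 2 * p"
    and upper: "s + 2 * p \<le> trib (N + 3) + pal_len (N + 1)"
    and N: "0 < N"
  shows "p = trib N"
proof -
  obtain k' i where ki: "p = sub_len (Suc k') (tr i)" "(phi ^^ Suc k') i \<le> s"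
    "s + 2 * p \<le> (phi ^^ Suc k') (Suc i) + pal_len (Suc k')"
    using squareE[OF sq] .
  define k where "k = Suc k'"
  have p: "p = sub_len k (tr i)" and start: "(phi ^^ k) i \<le> s"
    and stop: "s + 2 * p \<le> (phi ^^ k) (Suc i) + pal_len k"
    using ki by (simp_all only: k_def)
  have stop': "(phi ^^ k) (Suc i) + p \<le> s + 2 * p" using start p by (simp add: phi_pow_Suc)
  obtain N' where N': "N = Suc N'" using N not0_implies_Suc by blast
  have t3: "trib (N + 3) = trib (N + 2) + trib (N + 1) + trib N"
    by (rule trib_rec)
  have L1: "pal_len (N + 1) = pal_len N + trib N" and L2: "pal_len (N + 2) = pal_len N + trib N + trib (N + 1)"
    using pal_len_add_trib[of N] pal_len_add_trib[of "N + 1"] by simp_all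
  have LN: "pal_len N < trib N + trib N'" using pal_len_upper[of N'] by (simp only: N')
  have mono: "trib N' < trib N" "trib N < trib (N + 1)" "trib (N + 1) < trib (N + 2)"
    "trib (N + 2) < trib (N + 3)"
    using N' by (simp_all add: strict_mono_less[OF strict_mono_trib])
  have t1: "trib N + trib N' \<le> trib (N + 1)"
    using trib_Suc[of N] by (simp add: N' sub_len_Suc_B)
  have below: "i < c" if "trib (N + 3) = (phi ^^ k) c" for c
    using start s that strict_mono_less[OF strict_mono_phi_pow, of k i c] by simp
  consider "k \<le> N" | "k = N + 1" | "k = N + 2" | "k = N + 3" | "N + 4 \<le> k" by linarith
  then show ?thesis
  proof cases
    case 1
    \<comment> \<open>Block \<open>i\<close> ends by the boundary, so the square passes it by at
      most \<open>pal_len N\<close>.\<close>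
    then have t: "trib (N + 3) = (phi ^^ k) (trib (N + 3 - k))" by (simp add: phi_pow_trib)
    from below[OF this] have "(phi ^^ k) (Suc i) \<le> trib (N + 3)"
      unfolding t by (simp add: strict_mono_less_eq[OF strict_mono_phi_pow])
    moreover have "pal_len k \<le> pal_len N" using 1 by (simp add: strict_mono_less_eq[OF strict_mono_pal_len])
    ultimately show ?thesis using stop lower by simp
  next
    case 2
    \<comment> \<open>The boundary is preceded by the images of \<open>A\<close>, \<open>B\<close>,
      \<open>A\<close>, \<open>C\<close>. A square belonging to one of the first three ends at least
      \<open>trib N\<close> too early for a match of length \<open>pal_len (N + 1)\<close>.\<close>
    have t: "trib (N + 3) = (phi ^^ k) (Suc (Suc (Suc (Suc 0))))"
      using phi_pow_trib[of k 2] unfolding trib_2 2 by (simp add: eval_nat_numeral)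
    have "tr (Suc 0) = B" "tr (Suc (Suc 0)) = A" "tr (Suc (Suc (Suc 0))) = C"
      using tr_Suc_phi[of 0] tr_phi[of 1] tr_Suc_phi[of 1] tr_0
      by (simp_all add: phi_Suc phi_0)
    note letters = this
    show ?thesis
    proof (cases "i = Suc (Suc (Suc 0))")
      case True
      then show ?thesis using p letters by (simp add: 2 sub_len_Suc_C)
    next
      case False
      then have "Suc i \<le> Suc (Suc (Suc 0))" using below[OF t] by simp
      then have "(phi ^^ k) (Suc i) \<le> (phi ^^ k) (Suc (Suc (Suc 0)))"
        by (simp only: strict_mono_less_eq[OF strict_mono_phi_pow])
      moreover have "trib (N + 3) = (phi ^^ k) (Suc (Suc (Suc 0))) + trib N"
        unfolding t phi_pow_Suc[of k "Suc (Suc (Suc 0))"] letters using 2 by (simp add: sub_len_Suc_C)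
      ultimately show ?thesis using stop lower L1 2 by simp
    qed
  next
    case 3
    have t: "trib (N + 3) = (phi ^^ k) (Suc (Suc 0))"
      using phi_pow_trib[of k 1] unfolding trib_1 3 by (simp add: eval_nat_numeral)
    consider "i = 0" | "i = Suc 0" using below[OF t] by linarith
    then show ?thesis
    proof cases
      case 1
      then have "s + 2 * p \<le> trib (N + 2) + pal_len (N + 2)" using stop by (simp only: 3 phi_pow_1)
      then show ?thesis using lower L2 t3 by simp
    next
      case 2
      \<comment> \<open>The period of the \<open>B\<close> block exceeds
        \<open>pal_len (N + 1)\<close>, the room left after the boundary.\<close>
      have "tr (Suc 0) = B" using tr_Suc_phi[of 0] tr_0 by (simp add: phi_0)
      then have "p = trib (N + 1) + trib N" using p 3 2 by (simp add: sub_len_Suc_B sub_len_Suc_C)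
      moreover have "trib (N + 3) + p \<le> s + 2 * p" using stop' 2 t by simp
      ultimately show ?thesis using upper L1 LN mono t1 by linarith
    qed
  next
    case 4
    have "i = 0" using below[of "Suc 0"] by (simp add: phi_pow_1 4)
    then have "p = trib (N + 3)" using p 4 by (simp add: tr_0 sub_len_A)
    moreover have "trib (N + 3) + p \<le> s + 2 * p" using stop' \<open>i = 0\<close> by (simp only: phi_pow_1 4)
    ultimately show ?thesis using upper L1 LN mono t3 by simp
  next
    case 5
    have "trib (N + 4) \<le> trib k" using 5 by (simp add: strict_mono_less_eq[OF strict_mono_trib])
    also have "trib k \<le> (phi ^^ k) (Suc i)"
      unfolding phi_pow_1[symmetric] by (simp add: strict_mono_less_eq[OF strict_mono_phi_pow])
    finally have "trib (N + 4) \<le> s + 2 * p" using stop' by simp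
    moreover have "trib (N + 4) = trib (N + 3) + trib (N + 2) + trib (N + 1)"
      using trib_rec[of "N + 1"] by (simp add: numeral_eq_Suc)
    ultimately show ?thesis using upper L1 LN mono t1 by linarith
  qed
qed

text \<open>The square is the image of the match between the \<open>C\<close> at position \<open>3\<close> and the following \<open>A\<close>.\<close>

lemma square_at_trib:
  assumes "trib (N + 3) \<le> s + trib N" and "s + 2 * trib N \<le> trib (N + 3) + pal_len (N + 1)"
  shows "square s (trib N)"
proof -
  define f where "f = (phi ^^ (N + 1))"
  let ?c = "Suc (Suc (Suc 0))"
  have "tr ?c = C" using tr_Suc_phi[of 1] tr_0 tr_Suc_phi[of 0] by (simp add: phi_Suc phi_0)
  then have f: "f (Suc ?c) = f ?c + trib N"
    unfolding f_def phi_pow_Suc[of "N + 1" ?c] by (simp add: sub_len_Suc_C)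
  have t: "trib (N + 3) = f (Suc ?c)"
    unfolding f_def using phi_pow_trib[of "N + 1" 2] unfolding trib_2 by (simp add: eval_nat_numeral)
  have ag: "tr (f ?c + x) = tr (f (Suc ?c) + x)" if "x < pal_len (N + 1)" for x
    using agree_pal_len[of "N + 1" ?c] agree_pal_len[of "N + 1" "Suc ?c"] that
    unfolding f_def agree_def by metis
  have "agree s (s + trib N) (trib N)"
    unfolding agree_def
  proof (intro allI impI)
    fix x assume "x < trib N"
    then have "s + x - f ?c < pal_len (N + 1)" "f ?c + (s + x - f ?c) = s + x"
      "f (Suc ?c) + (s + x - f ?c) = s + trib N + x"
      using assms t f by linarith+
    then show "tr (s + x) = tr (s + trib N + x)" using ag by metis
  qed
  then show ?thesis by (simp add: square_def trib_pos)
qed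

lemma square_shift:
  assumes "agree t 0 l" and "s + 2 * p \<le> l"
  shows "square (t + s) p \<longleftrightarrow> square s p"
proof -
  have "tr (t + x) = tr x" if "x < l" for x using assms(1) that by (simp add: agree_def)
  then have "tr (t + s + x) = tr (s + x)" "tr (t + s + p + x) = tr (s + p + x)" if "x < p" for x
    using assms(2) that by (simp_all add: add.assoc)
  then show ?thesis by (simp add: square_def agree_def)
qed

text \<open>Squares starting at or after \<open>trib (N + 3)\<close> are copies of those ending at
  \<open>n - trib (N + 3)\<close>. A square starting earlier has period \<open>trib N\<close>, and
  starting earlier then means \<open>n < trib (N + 3) + 2 * trib N\<close>.\<close>

lemma a_shift:
  assumes "3 \<le> N" and lower: "trib (N + 3) + pal_len N < n"
    and upper: "n \<le> trib (N + 3) + pal_len (N + 1)"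
  shows "a n = a (n - trib (N + 3)) + (if n < trib (N + 3) + 2 * trib N then 1 else 0)"
proof -
  let ?t = "trib (N + 3)"
  define S where "S n = {p. \<exists>s. square s p \<and> s + 2 * p = n}" for n
  have fin: "finite (S n)" for n by (rule finite_subset[of _ "{..n}"]) (auto simp: S_def)
  have "pal_len (N + 1) \<le> pal_len (N + 3)"
    by (simp add: strict_mono_less_eq[OF strict_mono_pal_len])
  then have ag: "agree ?t 0 (n - ?t)"
    using agree_pal_len[of "N + 3" "Suc 0"] upper unfolding phi_pow_1 agree_def by simp
  have inside: "p \<in> S (n - ?t)" if "square s p" "s + 2 * p = n" "?t \<le> s" for s p
    using square_shift[OF ag, of "s - ?t" p] that unfolding S_def
    by (intro CollectI exI[of _ "s - ?t"]) simp
  have sub: "S (n - ?t) \<subseteq> S n"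
  proof
    fix p assume "p \<in> S (n - ?t)"
    then obtain s where "square s p" "s + 2 * p = n - ?t" by (auto simp: S_def)
    then show "p \<in> S n"
      using square_shift[OF ag, of s p] lower unfolding S_def
      by (intro CollectI exI[of _ "?t + s"]) simp
  qed
  have strad: "p = trib N \<and> n < ?t + 2 * trib N" if p: "p \<in> S n" "p \<notin> S (n - ?t)" for p
  proof -
    obtain s where s: "square s p" "s + 2 * p = n" using p(1) by (auto simp: S_def)
    have "s < ?t" using inside[OF s] p(2) not_le by blast
    then have "p = trib N"
      using straddling_square_period[OF s(1)] s(2) lower upper assms(1) by simp
    then show ?thesis using s(2) \<open>s < ?t\<close> by simp
  qed
  show ?thesis
  proof (cases "n < ?t + 2 * trib N")
    case True
    \<comment> \<open>Together with \<open>lower\<close> this puts the middle of the square of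
      period \<open>trib N\<close> at or after the boundary, as \<open>square_at_trib\<close>
      requires.\<close>
    have "trib N \<le> pal_len N + 1"
    proof -
      obtain M where M: "N = Suc (Suc (Suc M))" using assms(1) by (metis add_2_eq_Suc le_Suc_ex numeral_3_eq_3 plus_nat.simps(2))
      show ?thesis
        using strict_mono_less[OF strict_mono_trib, of M "Suc (Suc M)"]
          pal_len_closed[of "Suc (Suc M)"] trib_Suc3[of "Suc M"] trib_Suc3[of M]
        unfolding M by simp
    qed
    moreover have "2 * trib N \<le> n" using lower calculation trib_rec[of N]
      strict_mono_less[OF strict_mono_trib, of N "N + 1"] by simp
    ultimately have "square (n - 2 * trib N) (trib N)"
      using square_at_trib[of N "n - 2 * trib N"] lower upper by simp
    then have "trib N \<in> S n" using \<open>2 * trib N \<le> n\<close> unfolding S_def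
      by (intro CollectI exI[of _ "n - 2 * trib N"]) simp
    moreover have "trib N \<notin> S (n - ?t)" using True lower by (auto simp: S_def)
    ultimately have "S n = insert (trib N) (S (n - ?t))" using sub strad by blast
    then show ?thesis
      using \<open>trib N \<notin> S (n - ?t)\<close> True fin unfolding a_eq_card_squares S_def[symmetric] by simp
  next
    case False
    then have "S n = S (n - ?t)" using sub strad by blast
    then show ?thesis using False unfolding a_eq_card_squares S_def[symmetric] by simp
  qed
qed

subsection \<open>The intervals of consecutive integers\<close>

lemma Collect_real_interval:
  assumes "x = real k" and "y = real l"
  shows "{i. x \<le> real i \<and> real i \<le> y} = {k..l}"
  using assms by auto

text \<open>Writing \<open>m = r + 4\<close> removes subtraction of indices. The three intervals are
  adjacent and together fill \<open>{pal_len (r + 3) + 1..pal_len (r + 4)}\<close>.\<close>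

lemma gamma_intervals:
  fixes r :: nat
  shows gamma3_interval: "gamma3 (r + 4) = {pal_len (r + 3) + 1..trib (r + 3) + pal_len (r + 1)}"
    and gamma2_interval:
      "gamma2 (r + 4) = {trib (r + 3) + pal_len (r + 1) + 1..trib (r + 3) + pal_len (r + 2)}"
    and gamma1_interval: "gamma1 (r + 4) = {trib (r + 3) + pal_len (r + 2) + 1..pal_len (r + 4)}"
proof -
  have idx: "r + 4 - 1 = r + 3" "r + 4 - 2 = r + 2" by simp_all
  have suc: "r + 1 = Suc r" "r + 2 = Suc (Suc r)" "r + 3 = Suc (Suc (Suc r))"
    "r + 4 = Suc (Suc (Suc (Suc r)))" by simp_all
  note facts = pal_len_closed[of r] pal_len_closed[of "Suc r"] pal_len_closed[of "Suc (Suc r)"]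
    pal_len_closed[of "Suc (Suc (Suc r))"] trib_Suc3[of r] trib_Suc3[of "Suc r"]
    trib_Suc3[of "Suc (Suc r)"]
  define t where "t k = real (trib k)" for k
  define l where "l k = real (pal_len k)" for k
  note real_facts = facts[THEN arg_cong[of _ _ real],
      unfolded of_nat_add of_nat_mult of_nat_numeral, folded t_def l_def]
  show "gamma3 (r + 4) = {pal_len (r + 3) + 1..trib (r + 3) + pal_len (r + 1)}"
    unfolding gamma3_def idx
    by (rule Collect_real_interval;
        unfold suc of_nat_add of_nat_1, fold t_def l_def; use real_facts in argo)
  show "gamma2 (r + 4) = {trib (r + 3) + pal_len (r + 1) + 1..trib (r + 3) + pal_len (r + 2)}"
    unfolding gamma2_def idx
    by (rule Collect_real_interval;
        unfold suc of_nat_add of_nat_1, fold t_def l_def; use real_facts in argo)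
  show "gamma1 (r + 4) = {trib (r + 3) + pal_len (r + 2) + 1..pal_len (r + 4)}"
    unfolding gamma1_def idx
    by (rule Collect_real_interval;
        unfold suc of_nat_add of_nat_1, fold t_def l_def; use real_facts in argo)
qed

text \<open>The four \<theta> are translates by \<open>trib (r + 6)\<close> of the points where the
  intervals of index \<open>r + 4\<close> begin and of the point after the last one;
  \<open>eta1\<close> is where the straddling square stops contributing.\<close>

lemma theta_eq:
  fixes r :: nat
  shows theta1_eq: "theta1 (r + 7) = real (trib (r + 6) + pal_len (r + 3) + 1)"
    and theta2_eq: "theta2 (r + 7) = real (trib (r + 6) + trib (r + 3) + pal_len (r + 1) + 1)"
    and theta3_eq: "theta3 (r + 7) = real (trib (r + 6) + trib (r + 3) + pal_len (r + 2) + 1)"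
    and theta4_eq: "theta4 (r + 7) = real (trib (r + 6) + pal_len (r + 4) + 1)"
    and eta1_eq: "eta1 (r + 7) = real (trib (r + 6) + 2 * trib (r + 3))"
    and eta1_minus_theta1: "(- 5 * real (trib (r + 7)) + 10 * real (trib (r + 6)) - real (trib (r + 5)) + 1) / 2
      = 2 * real (trib (r + 3)) - real (pal_len (r + 3)) - 1"
proof -
  have idx: "r + 7 - 1 = r + 6" "r + 7 - 2 = r + 5" by simp_all
  have suc: "r + 1 = Suc r" "r + 2 = Suc (Suc r)" "r + 3 = Suc (Suc (Suc r))"
    "r + 4 = Suc (Suc (Suc (Suc r)))" "r + 5 = Suc (Suc (Suc (Suc (Suc r))))"
    "r + 6 = Suc (Suc (Suc (Suc (Suc (Suc r)))))"
    "r + 7 = Suc (Suc (Suc (Suc (Suc (Suc (Suc r))))))"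
    by simp_all
  note facts = pal_len_closed[of r] pal_len_closed[of "Suc r"] pal_len_closed[of "Suc (Suc r)"]
    pal_len_closed[of "Suc (Suc (Suc r))"] trib_Suc3[of r] trib_Suc3[of "Suc r"]
    trib_Suc3[of "Suc (Suc r)"] trib_Suc3[of "Suc (Suc (Suc r))"]
    trib_Suc3[of "Suc (Suc (Suc (Suc r)))"]
  define t where "t k = real (trib k)" for k
  define l where "l k = real (pal_len k)" for k
  note real_facts = facts[THEN arg_cong[of _ _ real],
      unfolded of_nat_add of_nat_mult of_nat_numeral, folded t_def l_def]
  show "theta1 (r + 7) = real (trib (r + 6) + pal_len (r + 3) + 1)"
    unfolding theta1_def idx unfolding suc of_nat_add of_nat_mult of_nat_numeral of_nat_1
    unfolding t_def[symmetric] l_def[symmetric] using real_facts by argo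
  show "theta2 (r + 7) = real (trib (r + 6) + trib (r + 3) + pal_len (r + 1) + 1)"
    unfolding theta2_def idx unfolding suc of_nat_add of_nat_mult of_nat_numeral of_nat_1
    unfolding t_def[symmetric] l_def[symmetric] using real_facts by argo
  show "theta3 (r + 7) = real (trib (r + 6) + trib (r + 3) + pal_len (r + 2) + 1)"
    unfolding theta3_def idx unfolding suc of_nat_add of_nat_mult of_nat_numeral of_nat_1
    unfolding t_def[symmetric] l_def[symmetric] using real_facts by argo
  show "theta4 (r + 7) = real (trib (r + 6) + pal_len (r + 4) + 1)"
    unfolding theta4_def idx unfolding suc of_nat_add of_nat_mult of_nat_numeral of_nat_1
    unfolding t_def[symmetric] l_def[symmetric] using real_facts by argo
  show "eta1 (r + 7) = real (trib (r + 6) + 2 * trib (r + 3))"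
    unfolding eta1_def idx unfolding suc of_nat_add of_nat_mult of_nat_numeral of_nat_1
    unfolding t_def[symmetric] l_def[symmetric] using real_facts by argo
  show "(- 5 * real (trib (r + 7)) + 10 * real (trib (r + 6)) - real (trib (r + 5)) + 1) / 2
      = 2 * real (trib (r + 3)) - real (pal_len (r + 3)) - 1"
    unfolding suc unfolding t_def[symmetric] l_def[symmetric] using real_facts by argo
qed

section \<open>Summation over an interval\<close>

text \<open>\<open>a_shift\<close> is summed with \<open>N = r + 3\<close>; the \<open>min\<close>
  counts the indices up to \<open>n\<close> at which the straddling square contributes.\<close>

lemma sum_a_shift:
  fixes r :: nat
  assumes lower: "trib (r + 6) + pal_len (r + 3) < n" and upper: "n \<le> trib (r + 6) + pal_len (r + 4)"
  shows "(\<Sum>i = trib (r + 6) + pal_len (r + 3) + 1..n. a i)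
      = (\<Sum>i = pal_len (r + 3) + 1..n - trib (r + 6). a i)
        + (min n (trib (r + 6) + 2 * trib (r + 3) - 1) - (trib (r + 6) + pal_len (r + 3)))"
proof -
  let ?t = "trib (r + 6)" and ?b = "pal_len (r + 3) + 1"
  let ?e = "?t + 2 * trib (r + 3)"
  have idx: "r + 3 + 3 = r + 6" "r + 3 + 1 = r + 4" by simp_all
  have shift: "a (i + ?t) = a i + (if i + ?t < ?e then 1 else 0)" if "i \<in> {?b..n - ?t}" for i
    using a_shift[of "r + 3" "i + ?t", unfolded idx] that upper lower by auto
  have "(\<Sum>i = ?t + ?b..n. a i) = (\<Sum>i = ?b + ?t..(n - ?t) + ?t. a i)"
    using lower by (simp add: add.commute)
  also have "\<dots> = (\<Sum>i = ?b..n - ?t. a (i + ?t))" by (rule sum.shift_bounds_cl_nat_ivl)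
  also have "\<dots> = (\<Sum>i = ?b..n - ?t. a i + (if i + ?t < ?e then 1 else 0))"
    by (rule sum.cong[OF refl shift])
  also have "\<dots> = (\<Sum>i = ?b..n - ?t. a i) + card {i \<in> {?b..n - ?t}. i + ?t < ?e}"
    by (simp only: sum.distrib) (simp add: sum.If_cases Int_def)
  also have "{i \<in> {?b..n - ?t}. i + ?t < ?e} = {?b..min n (?e - 1) - ?t}"
    using lower trib_pos[of "r + 3"] by (auto)
  also have "card \<dots> = min n (?e - 1) - (?t + pal_len (r + 3))" by simp
  finally show ?thesis by (simp only: add.assoc)
qed

lemma pal_len_add_3: "pal_len (k + 3) = trib (k + 3) + pal_len k"
  using pal_len_add_trib[of k] pal_len_add_trib[of "k + 1"] pal_len_add_trib[of "k + 2"] trib_rec[of k]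
  by (simp add: numeral_eq_Suc)

text \<open>The right endpoints grow with \<open>m\<close>, and for \<open>m = 6\<close> the
  endpoint is 31.\<close>

lemma gamma3_index_ge_7:
  assumes "52 \<le> n" and "4 \<le> m" and "n \<in> gamma3 m"
  shows "7 \<le> m"
proof (rule ccontr)
  assume "\<not> 7 \<le> m"
  obtain r where r: "m = r + 4" using assms(2) by (metis add.commute le_Suc_ex)
  then have "r \<le> 2" using \<open>\<not> 7 \<le> m\<close> by simp
  have "n \<le> trib (r + 3) + pal_len (r + 1)"
    using assms(3) unfolding r gamma3_interval by simp
  also have "\<dots> \<le> trib 5 + pal_len 3"
    using \<open>r \<le> 2\<close>
    by (intro add_mono) (simp_all add: strict_mono_less_eq[OF strict_mono_trib]
        strict_mono_less_eq[OF strict_mono_pal_len])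
  also have "\<dots> = 31"
    using trib_Suc3[of 0] trib_Suc3[of "Suc 0"] trib_Suc3[of "Suc (Suc 0)"] pal_len_add_3[of 0]
    by (simp add: trib_0 trib_1[simplified] trib_2[unfolded numeral_2_eq_2] eval_nat_numeral)
  finally show False using assms(1) by simp
qed

lemma sum_split_nat:
  fixes f :: "nat \<Rightarrow> nat"
  assumes "k \<le> l" and "l \<le> n"
  shows "sum f {k + 1..n} = sum f {l + 1..n} + sum f {k + 1..l}"
proof -
  have "{k + 1..n} = {l + 1..n} \<union> {k + 1..l}" using assms by auto
  then show ?thesis by (simp add: sum.union_disjoint)
qed

theorem mainTheorem8:
  fixes n m :: nat
  assumes "52 \<le> n" and "4 \<le> m" and "n \<in> gamma3 m"
  shows "7 \<le> m
    \<and> (theta1 m \<le> real n \<and> real n < theta2 m \<longrightarrow>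
         real (\<Sum>i = Min (gamma3 m)..n. a i) =
           real (\<Sum>i = Min (gamma3 (m - 3))..n - trib (m - 1). a i)
           + real n - real (Min (gamma3 m)) + 1)
    \<and> (theta2 m \<le> real n \<and> real n < theta3 m \<longrightarrow>
         real (\<Sum>i = Min (gamma3 m)..n. a i) =
           real (\<Sum>i = Min (gamma2 (m - 3))..n - trib (m - 1). a i)
           + real (sum a (gamma3 (m - 3)))
           + real n - real (Min (gamma3 m)) + 1)
    \<and> (theta3 m \<le> real n \<and> real n < eta1 m \<longrightarrow>
         real (\<Sum>i = Min (gamma3 m)..n. a i) =
           real (\<Sum>i = Min (gamma1 (m - 3))..n - trib (m - 1). a i)
           + real (sum a (gamma3 (m - 3))) + real (sum a (gamma2 (m - 3)))
           + real n - real (Min (gamma3 m)) + 1)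
    \<and> (\<not> (theta1 m \<le> real n \<and> real n < theta2 m)
       \<and> \<not> (theta2 m \<le> real n \<and> real n < theta3 m)
       \<and> \<not> (theta3 m \<le> real n \<and> real n < eta1 m) \<longrightarrow>
         real (\<Sum>i = Min (gamma3 m)..n. a i) =
           real (\<Sum>i = Min (gamma1 (m - 3))..n - trib (m - 1). a i)
           + real (sum a (gamma3 (m - 3))) + real (sum a (gamma2 (m - 3)))
           + (- 5 * real (trib m) + 10 * real (trib (m - 1)) - real (trib (m - 2)) + 1) / 2)
    \<and> (\<not> (theta1 m \<le> real n \<and> real n < theta2 m)
       \<and> \<not> (theta2 m \<le> real n \<and> real n < theta3 m)
       \<and> \<not> (theta3 m \<le> real n \<and> real n < eta1 m)
       \<longleftrightarrow> eta1 m \<le> real n \<and> real n < theta4 m)"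
proof -
  have "7 \<le> m" using gamma3_index_ge_7 assms by blast
  then obtain r where r: "m = r + 7" by (metis add.commute le_Suc_ex)
  have idx: "r + 7 - 1 = r + 6" "r + 7 - 2 = r + 5" "r + 7 - 3 = r + 4" by simp_all
  \<comment> \<open>\<open>t\<close> is the translation; \<open>l0\<close>, \<open>l1\<close>,
    \<open>l2\<close>, \<open>l3\<close> cut out the three intervals of index \<open>r + 4\<close>,
    and \<open>t + 2 * q\<close> is \<open>eta1\<close>.\<close>
  define t where "t = trib (r + 6)"
  define q where "q = trib (r + 3)"
  define l0 where "l0 = pal_len (r + 3)"
  define l1 where "l1 = q + pal_len (r + 1)"
  define l2 where "l2 = q + pal_len (r + 2)"
  define l3 where "l3 = pal_len (r + 4)"
  have l3: "l3 = q + l0" using pal_len_add_trib[of "r + 3"] by (simp add: l3_def q_def l0_def add.commute)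
  have "pal_len r < pal_len (r + 1)" "pal_len (r + 1) < pal_len (r + 2)"
    "pal_len (r + 2) < pal_len (r + 3)"
    by (simp_all add: strict_mono_less[OF strict_mono_pal_len])
  then have ord: "l0 < l1" "l1 < l2" "l2 < l3"
    unfolding l3 by (simp_all add: l0_def l1_def l2_def q_def pal_len_add_3)
  have "pal_len (r + 2) < q"
    using pal_len_upper[of "r + 1"] trib_rec[of r] trib_pos[of r] by (simp add: q_def)
  \<comment> \<open>So \<open>eta1\<close> is not below \<open>theta3\<close>, and the first two
    ranges lie before \<open>eta1\<close>.\<close>
  then have l2_less: "l2 < 2 * q" by (simp add: l2_def)
  have g3': "gamma3 (r + 7) = {t + l0 + 1..t + l3}"
    using gamma3_interval[of "r + 3"] pal_len_add_3[of "r + 3"] by (simp add: t_def l0_def l3_def ac_simps)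
  have g3: "gamma3 (r + 4) = {l0 + 1..l1}" and g2: "gamma2 (r + 4) = {l1 + 1..l2}"
    and g1: "gamma1 (r + 4) = {l2 + 1..l3}"
    by (simp_all only: gamma_intervals l0_def l1_def l2_def l3_def q_def)
  have Min_ivl: "Min {x..y} = x" if "x \<le> y" for x y :: nat
    using that by (intro Min_eqI) auto
  have mins: "Min (gamma3 (r + 7)) = t + l0 + 1" "Min (gamma3 (r + 4)) = l0 + 1"
    "Min (gamma2 (r + 4)) = l1 + 1" "Min (gamma1 (r + 4)) = l2 + 1"
    using ord by (simp_all add: g3' g3 g2 g1 Min_ivl)
  have n: "t + l0 < n" "n \<le> t + l3" using assms(3) by (simp_all add: r g3')
  have th: "theta1 (r + 7) = real (t + l0 + 1)" "theta2 (r + 7) = real (t + l1 + 1)"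
    "theta3 (r + 7) = real (t + l2 + 1)" "theta4 (r + 7) = real (t + l3 + 1)"
    "eta1 (r + 7) = real (t + 2 * q)"
    by (simp_all only: theta_eq t_def q_def l0_def l1_def l2_def l3_def add.assoc)
  have const: "(- 5 * real (trib (r + 7)) + 10 * real t - real (trib (r + 5)) + 1) / 2
      = 2 * real q - real l0 - 1"
    unfolding t_def q_def l0_def by (rule eta1_minus_theta1)
  have total: "sum a {t + l0 + 1..n} = sum a {l0 + 1..n - t} + (min n (t + 2 * q - 1) - (t + l0))"
    using sum_a_shift[of r n] n by (simp only: t_def q_def l0_def l3_def)
  have split2: "sum a {l0 + 1..n - t} = sum a {l1 + 1..n - t} + sum a {l0 + 1..l1}" if "t + l1 < n"
    using sum_split_nat[of l0 l1 "n - t" a] ord that by simp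
  have split3: "sum a {l0 + 1..n - t}
      = sum a {l2 + 1..n - t} + sum a {l0 + 1..l1} + sum a {l1 + 1..l2}" if "t + l2 < n"
    using sum_split_nat[of l1 l2 "n - t" a] split2 ord that by simp
  have before: "real (sum a {t + l0 + 1..n}) = real (sum a {l0 + 1..n - t}) + real n - real (t + l0 + 1) + 1"
    if "n < t + 2 * q"
    unfolding total using that n by (simp add: min_def of_nat_diff)
  have after: "real (sum a {t + l0 + 1..n}) = real (sum a {l0 + 1..n - t}) + (2 * real q - real l0 - 1)"
    if "t + 2 * q \<le> n"
    unfolding total using that n l2_less ord by (simp add: min_def of_nat_diff)
  show ?thesis
    unfolding r idx mins
    unfolding th t_def[symmetric] const g3 g2 of_nat_less_iff of_nat_le_iff
  proof (intro conjI impI)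
    show "7 \<le> r + 7" by simp
  next
    assume "t + l0 + 1 \<le> n \<and> n < t + l1 + 1"
    then show "real (sum a {t + l0 + 1..n}) = real (sum a {l0 + 1..n - t}) + real n
        - real (t + l0 + 1) + 1"
      using before ord l2_less by (simp del: of_nat_sum)
  next
    assume c: "t + l1 + 1 \<le> n \<and> n < t + l2 + 1"
    then have "n < t + 2 * q" using l2_less by simp
    from before[OF this] show "real (sum a {t + l0 + 1..n}) = real (sum a {l1 + 1..n - t})
        + real (sum a {l0 + 1..l1}) + real n - real (t + l0 + 1) + 1"
      using split2 c by (simp del: of_nat_sum)
  next
    assume c: "t + l2 + 1 \<le> n \<and> n < t + 2 * q"
    from before this show "real (sum a {t + l0 + 1..n}) = real (sum a {l2 + 1..n - t})
        + real (sum a {l0 + 1..l1}) + real (sum a {l1 + 1..l2}) + real n - real (t + l0 + 1) + 1"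
      using split3 by (simp del: of_nat_sum)
  next
    assume "\<not> (t + l0 + 1 \<le> n \<and> n < t + l1 + 1) \<and> \<not> (t + l1 + 1 \<le> n \<and> n < t + l2 + 1)
      \<and> \<not> (t + l2 + 1 \<le> n \<and> n < t + 2 * q)"
    then have "t + 2 * q \<le> n" using n by linarith
    from after[OF this] this show "real (sum a {t + l0 + 1..n}) = real (sum a {l2 + 1..n - t})
        + real (sum a {l0 + 1..l1}) + real (sum a {l1 + 1..l2}) + (2 * real q - real l0 - 1)"
      using split3 l2_less by (simp del: of_nat_sum)
  next
    show "(\<not> (t + l0 + 1 \<le> n \<and> n < t + l1 + 1) \<and> \<not> (t + l1 + 1 \<le> n \<and> n < t + l2 + 1)
      \<and> \<not> (t + l2 + 1 \<le> n \<and> n < t + 2 * q)) \<longleftrightarrow> (t + 2 * q \<le> n \<and> n < t + l3 + 1)"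
      \<comment> \<open>Membership in \<Gamma>_3 already gives
        \<open>theta1 m \<le> n < theta4 m\<close>, so outside the first three ranges
        \<open>eta1 m \<le> n\<close> remains.\<close>
      using n ord l2_less by linarith
  qed
qed

end
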